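(* Let $n\ge 10$, $k\in\{2,\dots,n-8\}$, $s\in\{0,\dots,\lfloor\frac{k-2}{2}\rfloor\}$, and let $p^{(k-2s)}$ be a homogeneous polynomial on $\mathbb{R}^n$ of degree $k-2s$ with $\Delta p^{(k-2s)}=0$. Write $r=|x|$. Then the equation on $\mathbb{R}^n$ $$\Delta^2\Psi-(n-2)n(n+2)(n+4)(1+r^2)^{-4}\Psi=-\mathfrak{L}_1[r^{2s}p^{(k-2s)}]w,$$ where $$\mathfrak{L}_1[r^{2s}p^{(k-2s)}]w:=\frac{n-4}{2(n-1)}\left[\frac{(k+2)(n-6)r^{2s}}{(1+r^2)^{\frac{n-2}{2}}}+\frac{(n^2-4n+8)r^{2s}}{(1+r^2)^{\frac n2}}-\frac{s(2k-2s+n-2)r^{2s-2}}{(1+r^2)^{\frac{n-4}{2}}}\right]p^{(k-2s)},$$ has a solution of the form $$\Psi^{k,s}=\frac{n-4}{4(n-1)}\sum_{j=1}^{s+3}\Gamma_j(1+r^2)^{-\frac{n-2j}{2}}p^{(k-2s)},$$ where the real numbers $\Gamma_j=\Gamma_j(n,k,s)$ are given by $$(k-2s-1)\Gamma_1=2\Gamma_2,\qquad (k-2s)\Gamma_2=\frac{4(n-1)}{n-2}\Gamma_3,$$ $$(k-2s+j-2)\Gamma_j=\frac{2j(n-j+1)}{n-2j+2}\Gamma_{j+1}-\frac{(-1)^{s+3-j}}{2(n-2j+2)}\binom{s}{j-3}\qquad\text{for }j=3,\dots,s+2,$$ $$(k-s+1)\Gamma_{s+3}=-\frac{1}{2(n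-2s-4)}.$$
   Context: Here $w(x)=(1+|x|^2)^{-\frac{n-4}{2}}$, so that $w^{\frac{8}{n-4}}=(1+r^2)^{-4}$. When $s=0$ the third term in the bracket is absent (its coefficient is zero) and the range $j=3,\dots,s+2$ is empty. *)

theory Defs
  imports "HOL-Analysis.Analysis"
begin

(* A multi-index is a function 'n => nat; the zero polynomial is homogeneous of every degree. *)
definition homogeneous_polynomial :: "nat \<Rightarrow> (real ^ 'n \<Rightarrow> real) \<Rightarrow> bool" where
  "homogeneous_polynomial d p \<longleftrightarrow>
     (\<exists>c :: ('n \<Rightarrow> nat) \<Rightarrow> real. \<forall>x.
        p x = (\<Sum>\<alpha> \<in> {\<alpha>. (\<Sum>i\<in>UNIV. \<alpha> i) = d}. c \<alpha> * (\<Prod>i\<in>UNIV. (x $ i) ^ \<alpha> i)))"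

definition partial_deriv :: "'n \<Rightarrow> (real ^ 'n \<Rightarrow> real) \<Rightarrow> real ^ 'n \<Rightarrow> real" where
  "partial_deriv i f x = deriv (\<lambda>t. f (x + t *\<^sub>R axis i 1)) 0"

definition laplacian :: "(real ^ 'n \<Rightarrow> real) \<Rightarrow> real ^ 'n \<Rightarrow> real" where
  "laplacian f x = (\<Sum>i\<in>UNIV. partial_deriv i (partial_deriv i f) x)"

primrec C_k :: "nat \<Rightarrow> (real ^ 'n \<Rightarrow> real) \<Rightarrow> bool" where
  "C_k 0 f \<longleftrightarrow> continuous_on UNIV f"
| "C_k (Suc m) f \<longleftrightarrow> (\<forall>x. f differentiable (at x)) \<and> (\<forall>i. C_k m (partial_deriv i f))"

(* Below, n is the dimension of the domain.  For s = 0 the exponent 2 * s - 2 is truncated to 0,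
   but the coefficient of that term vanishes. *)
definition L1_w :: "nat \<Rightarrow> nat \<Rightarrow> nat \<Rightarrow> (real ^ 'n \<Rightarrow> real) \<Rightarrow> real ^ 'n \<Rightarrow> real" where
  "L1_w n k s p x =
     (real n - 4) / (2 * (real n - 1)) *
     ( (real k + 2) * (real n - 6) * norm x ^ (2 * s)
         / (1 + (norm x)\<^sup>2) powr ((real n - 2) / 2)
     + ((real n)\<^sup>2 - 4 * real n + 8) * norm x ^ (2 * s)
         / (1 + (norm x)\<^sup>2) powr (real n / 2)
     - real s * (2 * real k - 2 * real s + real n - 2) * norm x ^ (2 * s - 2)
         / (1 + (norm x)\<^sup>2) powr ((real n - 4) / 2)) * p x"

(* C^4 regularity makes the iterated partial derivatives in the bi-Laplacian genuine ones. *)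
definition is_solution :: "nat \<Rightarrow> nat \<Rightarrow> nat \<Rightarrow> (real ^ 'n \<Rightarrow> real) \<Rightarrow> (real ^ 'n \<Rightarrow> real) \<Rightarrow> bool" where
  "is_solution n k s p \<Psi> \<longleftrightarrow>
     C_k 4 \<Psi> \<and>
     (\<forall>x. laplacian (laplacian \<Psi>) x
           - (real n - 2) * real n * (real n + 2) * (real n + 4)
               * (1 + (norm x)\<^sup>2) powr (-4) * \<Psi> x
         = - L1_w n k s p x)"

definition Gamma_relations :: "nat \<Rightarrow> nat \<Rightarrow> nat \<Rightarrow> (nat \<Rightarrow> real) \<Rightarrow> bool" where
  "Gamma_relations n k s \<Gamma> \<longleftrightarrow>
     (real k - 2 * real s - 1) * \<Gamma> 1 = 2 * \<Gamma> 2 \<and>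
     (real k - 2 * real s) * \<Gamma> 2 = 4 * (real n - 1) / (real n - 2) * \<Gamma> 3 \<and>
     (\<forall>j\<in>{3..s + 2}.
        (real k - 2 * real s + real j - 2) * \<Gamma> j =
          2 * real j * (real n - real j + 1) / (real n - 2 * real j + 2) * \<Gamma> (j + 1)
          - (-1) ^ (s + 3 - j) / (2 * (real n - 2 * real j + 2)) * real (s choose (j - 3))) \<and>
     (real k - real s + 1) * \<Gamma> (s + 3) = - 1 / (2 * (real n - 2 * real s - 4))"

definition Psi :: "nat \<Rightarrow> nat \<Rightarrow> (nat \<Rightarrow> real) \<Rightarrow> (real ^ 'n \<Rightarrow> real) \<Rightarrow> real ^ 'n \<Rightarrow> real" where
  "Psi n s \<Gamma> p x =
     (real n - 4) / (4 * (real n - 1)) *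
     (\<Sum>j = 1..s + 3. \<Gamma> j * (1 + (norm x)\<^sup>2) powr (- (real n - 2 * real j) / 2) * p x)"

end

(* With v = 1 + |x|^2 and p harmonic and homogeneous of degree d = k - 2s, the Laplacian maps v^a p
   to a combination of v^(a-1) p and v^(a-2) p.  After division by p and a common power of v the
   equation is therefore a polynomial identity in v = r^2 + 1, in which each coefficient involves
   three consecutive Gamma_j.  Extending Gamma by zero outside 1..s+3, all the defining relations
   become one two-term recurrence, whose inhomogeneity delta_j is, up to a factor, the coefficient
   of v^j in v^3 (v-1)^s; applying it twice cancels every Gamma_j and leaves the right-hand side. *)

theory Submission
  imports Defs
begin

section \<open>Calculus of partial derivatives\<close>

text \<open>Chain rule along the line \<open>t \<mapsto> x + t *\<^sub>R axis i 1\<close>. This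
  bridge lets every later partial derivative be read off from a Frechet derivative.\<close>

lemma partial_deriv_eq:
  assumes "(f has_derivative f') (at x)"
  shows "partial_deriv i f x = f' (axis i 1)"
proof -
  have f': "(f has_derivative f') (at (x + 0 *\<^sub>R axis i 1))"
    using assms by simp
  have "((\<lambda>t. x + t *\<^sub>R axis i 1) has_derivative (\<lambda>t. t *\<^sub>R axis i 1)) (at 0)"
    by (auto intro!: derivative_eq_intros)
  from has_derivative_compose[OF this f']
  have "((\<lambda>t. f (x + t *\<^sub>R axis i 1)) has_derivative (\<lambda>t. f' (t *\<^sub>R axis i 1))) (at 0)" .
  moreover have "f' (t *\<^sub>R axis i 1) = f' (axis i 1) * t" for t
    using linear_scale[OF has_derivative_linear[OF assms]] by simp
  ultimately have "((\<lambda>t. f (x + t *\<^sub>R axis i 1)) has_real_derivative f' (axis i 1)) (at 0)"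
    by (simp add: has_field_derivative_def)
  then show ?thesis
    unfolding partial_deriv_def by (rule DERIV_imp_deriv)
qed

lemma partial_deriv_const [simp]: "partial_deriv i (\<lambda>x. c) = (\<lambda>x. 0)"
  by (rule ext, subst partial_deriv_eq[OF has_derivative_const]) simp

lemma partial_deriv_component:
  "partial_deriv i (\<lambda>x. x $ j) = (\<lambda>x. if i = j then 1 else 0)"
  by (rule ext, subst partial_deriv_eq[where f' = "\<lambda>h. h $ j"])
     (auto intro!: bounded_linear_imp_has_derivative bounded_linear_vec_nth simp: axis_def)

lemma partial_deriv_add:
  assumes "\<And>x. f differentiable (at x)" "\<And>x. g differentiable (at x)"
  shows "partial_deriv i (\<lambda>x. f x + g x) = (\<lambda>x. partial_deriv i f x + partial_deriv i g x)"
proof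
  fix x
  obtain f' g' where "(f has_derivative f') (at x)" "(g has_derivative g') (at x)"
    using assms unfolding differentiable_def by blast
  then show "partial_deriv i (\<lambda>x. f x + g x) x = partial_deriv i f x + partial_deriv i g x"
    using partial_deriv_eq[OF has_derivative_add] by (simp add: partial_deriv_eq)
qed

lemma partial_deriv_mult:
  assumes "\<And>x. f differentiable (at x)" "\<And>x. g differentiable (at x)"
  shows "partial_deriv i (\<lambda>x. f x * g x) = (\<lambda>x. f x * partial_deriv i g x + partial_deriv i f x * g x)"
proof
  fix x
  obtain f' g' where "(f has_derivative f') (at x)" "(g has_derivative g') (at x)"
    using assms unfolding differentiable_def by blast
  then show "partial_deriv i (\<lambda>x. f x * g x) x = f x * partial_deriv i g x + partial_deriv i f x * g x"
    using partial_deriv_eq[OF has_derivative_mult] by (simp add: partial_deriv_eq)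
qed

lemma one_plus_norm_sq_pos: "1 + (norm x)\<^sup>2 > 0"
  using zero_le_power2[of "norm x"] by linarith

lemma has_derivative_one_plus_norm_sq_powr:
  fixes x :: "'a::real_inner"
  shows "((\<lambda>x. (1 + (norm x)\<^sup>2) powr a) has_derivative
           (\<lambda>h. 2 * a * (x \<bullet> h) * (1 + (norm x)\<^sup>2) powr (a - 1))) (at x)"
proof -
  have "((\<lambda>x. 1 + (norm x)\<^sup>2) has_derivative (\<lambda>h. 2 * (x \<bullet> h))) (at x)"
    unfolding power2_norm_eq_inner
    by (auto intro!: derivative_eq_intros simp: inner_commute)
  moreover have "((\<lambda>y. y powr a) has_real_derivative a * (1 + (norm x)\<^sup>2) powr (a - 1))
      (at (1 + (norm x)\<^sup>2))"
    using one_plus_norm_sq_pos by (rule has_real_derivative_powr)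
  ultimately show ?thesis
    using has_derivative_compose unfolding has_field_derivative_def
    by (fastforce simp: mult_ac)
qed

lemma partial_deriv_one_plus_norm_sq_powr:
  "partial_deriv i (\<lambda>x. (1 + (norm x)\<^sup>2) powr a) =
     (\<lambda>x. 2 * a * (x $ i * (1 + (norm x)\<^sup>2) powr (a - 1)))"
  by (rule ext, subst partial_deriv_eq[OF has_derivative_one_plus_norm_sq_powr])
     (simp add: inner_axis)

lemma differentiable_one_plus_norm_sq_powr:
  fixes x :: "'a::real_inner"
  shows "(\<lambda>x. (1 + (norm x)\<^sup>2) powr a) differentiable (at x)"
  using has_derivative_one_plus_norm_sq_powr unfolding differentiable_def by blast

section \<open>Closure properties of the regularity classes \<open>C_k\<close>\<close>

text \<open>The product rule leaves undifferentiated factors, so the induction for products needs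
  \<open>f\<close> itself, not only its partial derivatives, in the lower class.\<close>

lemma C_k_SucD: "C_k (Suc m) f \<Longrightarrow> C_k m f"
proof (induction m arbitrary: f)
  case 0
  then show ?case
    by (auto intro!: continuous_at_imp_continuous_on differentiable_imp_continuous_within)
next
  case (Suc m)
  then show ?case by (metis C_k.simps(2))
qed

lemma C_k_const: "C_k m (\<lambda>x. c)"
  by (induction m arbitrary: c) auto

lemma C_k_component: "C_k m (\<lambda>x. x $ j)"
  by (cases m)
     (auto simp: partial_deriv_component C_k_const intro!: continuous_intros
        bounded_linear_imp_differentiable bounded_linear_vec_nth)

lemma C_k_add: "C_k m f \<Longrightarrow> C_k m g \<Longrightarrow> C_k m (\<lambda>x. f x + g x)"
  by (induction m arbitrary: f g)
     (auto intro!: continuous_intros differentiable_add simp: partial_deriv_add)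

lemma C_k_mult: "C_k m f \<Longrightarrow> C_k m g \<Longrightarrow> C_k m (\<lambda>x. f x * g x)"
proof (induction m arbitrary: f g)
  case 0
  then show ?case by (auto intro!: continuous_intros)
next
  case (Suc m)
  have "C_k m f" "C_k m g"
    using Suc.prems C_k_SucD by blast+
  with Suc show ?case
    by (auto intro!: differentiable_mult C_k_add simp: partial_deriv_mult)
qed

lemma C_k_sum: "(\<And>j. j \<in> J \<Longrightarrow> C_k m (f j)) \<Longrightarrow> C_k m (\<lambda>x. \<Sum>j\<in>J. f j x)"
  by (induction J rule: infinite_finite_induct) (auto intro: C_k_const C_k_add)

lemma C_k_prod: "(\<And>j. j \<in> J \<Longrightarrow> C_k m (f j)) \<Longrightarrow> C_k m (\<lambda>x. \<Prod>j\<in>J. f j x)"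
  by (induction J rule: infinite_finite_induct) (auto intro: C_k_const C_k_mult)

lemma C_k_power: "C_k m f \<Longrightarrow> C_k m (\<lambda>x. f x ^ l)"
  by (induction l) (auto intro: C_k_const C_k_mult)

text \<open>Differentiating gives a coordinate times a power with exponent \<open>a - 1\<close>,
  hence the induction over \<open>m\<close> for all exponents at once.\<close>

lemma C_k_one_plus_norm_sq_powr: "C_k m (\<lambda>x. (1 + (norm x)\<^sup>2) powr a)"
proof (induction m arbitrary: a)
  case 0
  have "(1 + (norm x)\<^sup>2) \<noteq> 0" for x :: "real ^ 'a"
    using one_plus_norm_sq_pos[of x] by linarith
  then show ?case by (auto intro!: continuous_intros)
next
  case (Suc m)
  then show ?case
    by (auto simp: differentiable_one_plus_norm_sq_powr partial_deriv_one_plus_norm_sq_powr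
        intro!: C_k_mult C_k_const C_k_component)
qed

section \<open>Homogeneous polynomials\<close>

lemma homogeneous_polynomial_C_k: "homogeneous_polynomial d p \<Longrightarrow> C_k m p"
proof -
  assume "homogeneous_polynomial d p"
  then obtain c where
    "p = (\<lambda>x. \<Sum>\<alpha> \<in> {\<alpha>. (\<Sum>i\<in>UNIV. \<alpha> i) = d}. c \<alpha> * (\<Prod>i\<in>UNIV. (x $ i) ^ \<alpha> i))"
    unfolding homogeneous_polynomial_def by blast
  then show "C_k m p"
    by (auto intro!: C_k_sum C_k_mult C_k_const C_k_prod C_k_power C_k_component)
qed

lemma homogeneous_polynomial_scale:
  assumes "homogeneous_polynomial d p"
  shows "p (t *\<^sub>R x) = t ^ d * p x"
proof -
  obtain c where p: "\<And>x. p x = (\<Sum>\<alpha> \<in> {\<alpha>. (\<Sum>i\<in>UNIV. \<alpha> i) = d}. c \<alpha> * (\<Prod>i\<in>UNIV. (x $ i) ^ \<alpha> i))"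
    using assms unfolding homogeneous_polynomial_def by blast
  have "c \<alpha> * (\<Prod>i\<in>UNIV. ((t *\<^sub>R x) $ i) ^ \<alpha> i) = t ^ d * (c \<alpha> * (\<Prod>i\<in>UNIV. (x $ i) ^ \<alpha> i))"
    if "(\<Sum>i\<in>UNIV. \<alpha> i) = d" for \<alpha>
    using that by (simp add: power_mult_distrib prod.distrib power_sum[symmetric] mult_ac)
  then show ?thesis
    unfolding p sum_distrib_left by (intro sum.cong) auto
qed

text \<open>Euler's identity: differentiate \<open>p (t *\<^sub>R x) = t ^ d * p x\<close> at
  \<open>t = 1\<close> in two ways and compare.\<close>

lemma homogeneous_polynomial_euler:
  assumes "homogeneous_polynomial d p"
  shows "(\<Sum>i\<in>UNIV. x $ i * partial_deriv i p x) = real d * p x"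
proof -
  have "p differentiable (at x)"
    using homogeneous_polynomial_C_k[OF assms, of 1] by simp
  then obtain p' where p': "(p has_derivative p') (at x)"
    unfolding differentiable_def by blast
  have "((\<lambda>t. t *\<^sub>R x) has_derivative (\<lambda>t. t *\<^sub>R x)) (at (1::real))"
    by (auto intro!: derivative_eq_intros)
  moreover have "(p has_derivative p') (at (1 *\<^sub>R x))"
    using p' by simp
  ultimately have "((\<lambda>t. p (t *\<^sub>R x)) has_derivative (\<lambda>t. p' (t *\<^sub>R x))) (at 1)"
    by (rule has_derivative_compose)
  moreover have "((\<lambda>t. p (t *\<^sub>R x)) has_derivative (\<lambda>t. t * (real d * p x))) (at 1)"
    unfolding homogeneous_polynomial_scale[OF assms]
    by (auto intro!: derivative_eq_intros)
  ultimately have "(\<lambda>t. p' (t *\<^sub>R x)) = (\<lambda>t. t * (real d * p x))"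
    by (rule has_derivative_unique)
  from fun_cong[OF this, of 1] have "real d * p x = p' x"
    by simp
  also have "\<dots> = p' (\<Sum>i\<in>UNIV. x $ i *\<^sub>R axis i 1)"
    using basis_expansion[of x] by (simp add: scalar_mult_eq_scaleR)
  also have "\<dots> = (\<Sum>i\<in>UNIV. x $ i * partial_deriv i p x)"
    using has_derivative_linear[OF p']
    by (simp add: linear_sum linear_scale partial_deriv_eq[OF p'])
  finally show ?thesis by simp
qed

section \<open>Laplacian and bi-Laplacian of a power of 1 + |x|^2 times a harmonic
  polynomial\<close>

lemma laplacian_add:
  assumes "C_k 2 f" "C_k 2 g"
  shows "laplacian (\<lambda>x. f x + g x) = (\<lambda>x. laplacian f x + laplacian g x)"
  using assms by (auto simp: laplacian_def numeral_2_eq_2 partial_deriv_add sum.distrib)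

lemma laplacian_cmult:
  assumes "C_k 2 f"
  shows "laplacian (\<lambda>x. c * f x) = (\<lambda>x. c * laplacian f x)"
  using assms
  by (auto simp: laplacian_def numeral_2_eq_2 partial_deriv_mult sum_distrib_left)

lemma laplacian_lincomb:
  assumes "\<And>j. j \<in> J \<Longrightarrow> C_k 2 (f j)"
  shows "laplacian (\<lambda>x. \<Sum>j\<in>J. c j * f j x) = (\<lambda>x. \<Sum>j\<in>J. c j * laplacian (f j) x)"
  using assms
proof (induction J rule: infinite_finite_induct)
  case (insert j J)
  then have "laplacian (\<lambda>x. c j * f j x + (\<Sum>j\<in>J. c j * f j x)) =
      (\<lambda>x. c j * laplacian (f j) x + laplacian (\<lambda>x. \<Sum>j\<in>J. c j * f j x) x)"
    by (subst laplacian_add) (auto intro!: C_k_mult C_k_sum C_k_const simp: laplacian_cmult)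
  with insert show ?case by simp
qed (auto simp: laplacian_def)

text \<open>In the Leibniz expansion the term with the Laplacian of \<open>p\<close> vanishes, and
  Euler's identity turns the gradient cross term into a multiple of \<open>p\<close>. Replacing
  |x|^2 by v - 1, with v = 1 + |x|^2, leaves only the exponents \<open>a - 1\<close> and
  \<open>a - 2\<close>.\<close>

lemma laplacian_powr_mult_harmonic:
  fixes p :: "real ^ 'n \<Rightarrow> real"
  assumes hom: "homogeneous_polynomial d p" and harm: "\<And>x. laplacian p x = 0"
  shows "laplacian (\<lambda>x. (1 + (norm x)\<^sup>2) powr a * p x) =
    (\<lambda>x. 4 * a * (a - 1 + real CARD('n) / 2 + real d) * ((1 + (norm x)\<^sup>2) powr (a - 1) * p x)
       + (- 4 * a * (a - 1)) * ((1 + (norm x)\<^sup>2) powr (a - 2) * p x))"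
proof
  fix x :: "real ^ 'n"
  define V where "V b x = (1 + (norm x)\<^sup>2) powr b" for b and x :: "real ^ 'n"
  have V_diff: "V b differentiable (at x)" for b x
    unfolding V_def by (rule differentiable_one_plus_norm_sq_powr)
  have dV: "partial_deriv i (V b) = (\<lambda>x. 2 * b * (x $ i * V (b - 1) x))" for i b
    unfolding V_def by (rule partial_deriv_one_plus_norm_sq_powr)
  have C2: "C_k 2 p"
    by (rule homogeneous_polynomial_C_k[OF hom])
  then have p_diff: "p differentiable (at x)" "partial_deriv i p differentiable (at x)" for i x
    by (auto simp: numeral_2_eq_2)
  have comp_diff: "(\<lambda>x :: real ^ 'n. x $ i) differentiable (at x)" for i x
    by (intro bounded_linear_imp_differentiable bounded_linear_vec_nth)
  have ddV: "partial_deriv i (\<lambda>x. 2 * a * (x $ i * V (a - 1) x)) =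
      (\<lambda>x. 4 * a * (a - 1) * (x $ i)\<^sup>2 * V (a - 2) x + 2 * a * V (a - 1) x)" for i
    by (rule ext) (simp add: partial_deriv_mult partial_deriv_component comp_diff V_diff dV
        power2_eq_square algebra_simps)
  have "partial_deriv i (partial_deriv i (\<lambda>x. V a x * p x)) x =
      V a x * partial_deriv i (partial_deriv i p) x
      + 4 * a * V (a - 1) x * (x $ i * partial_deriv i p x)
      + 4 * a * (a - 1) * V (a - 2) x * p x * (x $ i)\<^sup>2 + 2 * a * V (a - 1) x * p x" for i
    by (simp add: partial_deriv_mult partial_deriv_add V_diff p_diff comp_diff dV ddV
        differentiable_mult) (simp add: algebra_simps)
  then have "laplacian (\<lambda>x. V a x * p x) x =
      V a x * laplacian p x
      + 4 * a * V (a - 1) x * (\<Sum>i\<in>UNIV. x $ i * partial_deriv i p x)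
      + 4 * a * (a - 1) * V (a - 2) x * p x * (\<Sum>i\<in>UNIV. (x $ i)\<^sup>2)
      + real CARD('n) * (2 * a * V (a - 1) x * p x)"
    by (simp add: laplacian_def sum.distrib sum_distrib_left)
  also have "(\<Sum>i\<in>UNIV. (x $ i)\<^sup>2) = (norm x)\<^sup>2"
    by (simp add: norm_vec_def L2_set_def sum_nonneg)
  also have "(norm x)\<^sup>2 = (1 + (norm x)\<^sup>2) - 1"
    by simp
  also have "4 * a * (a - 1) * V (a - 2) x * p x * ((1 + (norm x)\<^sup>2) - 1) =
      4 * a * (a - 1) * (V (a - 2) x * (1 + (norm x)\<^sup>2)) * p x - 4 * a * (a - 1) * V (a - 2) x * p x"
    by (simp add: algebra_simps)
  also have "V (a - 2) x * (1 + (norm x)\<^sup>2) = V (a - 1) x"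
    using one_plus_norm_sq_pos[of x] powr_add[of "1 + (norm x)\<^sup>2" "a - 2" 1]
    by (simp add: V_def)
  finally show "laplacian (\<lambda>x. (1 + (norm x)\<^sup>2) powr a * p x) x =
      4 * a * (a - 1 + real CARD('n) / 2 + real d) * ((1 + (norm x)\<^sup>2) powr (a - 1) * p x)
       + (- 4 * a * (a - 1)) * ((1 + (norm x)\<^sup>2) powr (a - 2) * p x)"
    by (simp add: V_def harm homogeneous_polynomial_euler[OF hom] algebra_simps)
qed

text \<open>Lowering the exponent by 1 or 2 lowers \<open>b\<close> by the same amount. The exponent
  \<open>a - 3\<close> is reached by two routes, with factors \<open>b\<close> and
  \<open>b - 2\<close>; their sum is the \<open>2 * (b - 1)\<close> in the middle
  coefficient.\<close>

lemma bilaplacian_powr_mult_harmonic: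
  fixes p :: "real ^ 'n \<Rightarrow> real"
  assumes hom: "homogeneous_polynomial d p" and harm: "\<And>x. laplacian p x = 0"
    and b: "b = a - 1 + real CARD('n) / 2 + real d"
  shows "laplacian (laplacian (\<lambda>x. (1 + (norm x)\<^sup>2) powr a * p x)) x =
    (16 * a * (a - 1) * b * (b - 1) * (1 + (norm x)\<^sup>2) powr (a - 2)
     - 32 * a * (a - 1) * (a - 2) * (b - 1) * (1 + (norm x)\<^sup>2) powr (a - 3)
     + 16 * a * (a - 1) * (a - 2) * (a - 3) * (1 + (norm x)\<^sup>2) powr (a - 4)) * p x"
proof -
  define h where "h c x = (1 + (norm x)\<^sup>2) powr c * p x" for c and x :: "real ^ 'n"
  have C2: "C_k 2 (h c)" for c
    unfolding h_def
    by (intro C_k_mult C_k_one_plus_norm_sq_powr homogeneous_polynomial_C_k[OF hom])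
  have L: "laplacian (h c) = (\<lambda>x. 4 * c * (c - 1 + real CARD('n) / 2 + real d) * h (c - 1) x
      + (- 4 * c * (c - 1)) * h (c - 2) x)" for c
    unfolding h_def by (rule laplacian_powr_mult_harmonic[OF hom harm])
  have "laplacian (laplacian (h a)) x = 4 * a * b * laplacian (h (a - 1)) x
      + (- 4 * a * (a - 1)) * laplacian (h (a - 2)) x"
    unfolding L[of a] b
    by (subst laplacian_add) (simp_all only: laplacian_cmult C2 C_k_mult C_k_const)
  also have "\<dots> = (16 * a * (a - 1) * b * (b - 1) * (1 + (norm x)\<^sup>2) powr (a - 2)
     - 32 * a * (a - 1) * (a - 2) * (b - 1) * (1 + (norm x)\<^sup>2) powr (a - 3)
     + 16 * a * (a - 1) * (a - 2) * (a - 3) * (1 + (norm x)\<^sup>2) powr (a - 4)) * p x"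
    unfolding L b h_def by (simp add: algebra_simps)
  finally show ?thesis
    by (simp add: h_def[abs_def])
qed

section \<open>Coefficients of v^3 (v - 1)^s\<close>

lemma binomial_sum_minus_one:
  fixes v :: real
  shows "(\<Sum>i\<le>s. (- 1) ^ (s - i) * real (s choose i) * v ^ i) = (v - 1) ^ s"
  using binomial_ring[of v "- 1" s] by (simp add: mult_ac)

text \<open>This is v d/dv applied to the expansion of (v - 1)^s, obtained algebraically from the
  absorption identity i C(s, i) = s C(s - 1, i - 1).\<close>

lemma binomial_first_moment_minus_one:
  fixes v :: real
  shows "(\<Sum>i\<le>s. real i * ((- 1) ^ (s - i) * real (s choose i)) * v ^ i) =
    real s * v * (v - 1) ^ (s - 1)"
proof (cases s)
  case (Suc t)
  have "real (Suc i) * ((- 1) ^ (t - i) * real (Suc t choose Suc i)) * v ^ Suc i =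
      real s * v * ((- 1) ^ (t - i) * real (t choose i) * v ^ i)" (is "?f i = ?g i") for i
  proof -
    have "real (Suc i) * real (Suc t choose Suc i) = real s * real (t choose i)"
      unfolding Suc of_nat_mult[symmetric] Suc_times_binomial ..
    then show ?thesis by (simp del: binomial_Suc_Suc of_nat_Suc)
  qed
  then have "(\<Sum>i\<le>t. ?f i) = (\<Sum>i\<le>t. ?g i)"
    by (rule sum.cong[OF refl])
  moreover have "(\<Sum>i\<le>s. real i * ((- 1) ^ (s - i) * real (s choose i)) * v ^ i) = (\<Sum>i\<le>t. ?f i)"
    unfolding Suc sum.atMost_Suc_shift
    by (simp del: binomial_Suc_Suc of_nat_Suc power_Suc)
  ultimately show ?thesis
    by (simp only: sum_distrib_left[symmetric] binomial_sum_minus_one) (simp add: Suc)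
qed auto

text \<open>Index shift without boundary terms, used to align powers of v in different sums.\<close>

lemma sum_lessThan_shift_zero:
  fixes f :: "nat \<Rightarrow> 'a::ab_group_add"
  assumes "f 0 = 0" "f M = 0"
  shows "(\<Sum>j<M. f (Suc j)) = (\<Sum>j<M. f j)"
  using sum.lessThan_Suc_shift[of f M] assms by simp

text \<open>The coefficient of v^j in v^3 (v - 1)^s. For \<open>j > s + 3\<close> the subtraction in
  the sign is truncated, but the binomial coefficient is zero there.\<close>

definition binomial_coeff :: "nat \<Rightarrow> nat \<Rightarrow> real" where
  "binomial_coeff s j = (if j < 3 then 0 else (- 1) ^ (s + 3 - j) * real (s choose (j - 3)))"

text \<open>Coefficient form of v (v - 1) P' = (3 (v - 1) + s v) P for P = v^3 (v - 1)^s. The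
  factors vanish exactly at the ends of the support: the left one at \<open>j = 2\<close>, the right
  one at \<open>j = s + 3\<close>.\<close>

lemma binomial_coeff_step:
  "(real j - 2) * binomial_coeff s (Suc j) = - (real s - real j + 3) * binomial_coeff s j"
proof (cases "j < 3 \<or> s + 3 \<le> j")
  case True
  then show ?thesis
    by (cases "j = 2"; cases "j = s + 3") (auto simp: binomial_coeff_def binomial_eq_0)
next
  case False
  then obtain i where j: "j = i + 3" "i < s"
    by (metis add.commute le_add_diff_inverse less_or_eq_imp_le linorder_not_less nat_add_left_cancel_less)
  then obtain m where s: "s = Suc (i + m)"
    using less_imp_Suc_add by blast
  have "Suc i * (s choose Suc i) = (s - i) * (s choose i)"
    using binomial_absorb_comp[of s i] binomial_absorption[of i s] s by simp
  moreover have "s - i = Suc m"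
    using s by simp
  ultimately have "real (Suc i) * real (s choose Suc i) = real (Suc m) * real (s choose i)"
    by (simp only: of_nat_mult[symmetric])
  then have swap: "real (Suc i) * (e * real (s choose Suc i)) = - real (Suc m) * (- e * real (s choose i))"
    for e
    by (simp add: mult.left_commute del: of_nat_Suc binomial_Suc_Suc)
  have "binomial_coeff s (Suc j) = (- 1) ^ m * real (s choose Suc i)"
    "binomial_coeff s j = - ((- 1) ^ m) * real (s choose i)"
    "real j - 2 = real (Suc i)" "real s - real j + 3 = real (Suc m)"
    by (simp_all add: binomial_coeff_def j(1) s del: binomial_Suc_Suc)
  then show ?thesis
    by (simp only: swap)
qed

lemma binomial_coeff_sums:
  fixes v :: real
  shows "(\<Sum>j<s + 4. binomial_coeff s j * v ^ j) = v ^ 3 * (v - 1) ^ s" (is ?A)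
    and "(\<Sum>j<s + 4. (real j - 3) * binomial_coeff s j * v ^ j) = real s * v ^ 4 * (v - 1) ^ (s - 1)" (is ?B)
proof -
  have shift: "(\<Sum>j<s + 4. f j * binomial_coeff s j * v ^ j) =
      v ^ 3 * (\<Sum>i\<le>s. f (i + 3) * ((- 1) ^ (s - i) * real (s choose i)) * v ^ i)" for f
  proof -
    have "(\<Sum>j<s + 4. f j * binomial_coeff s j * v ^ j) =
        (\<Sum>i\<le>s. f (i + 3) * binomial_coeff s (i + 3) * v ^ (i + 3))"
      (is "sum ?g _ = _")
    proof -
      have "sum ?g {..<s + 4} = sum ?g {0 + 3..s + 3}"
        by (intro sum.mono_neutral_right) (auto simp: binomial_coeff_def)
      then show ?thesis
        by (simp only: sum.shift_bounds_cl_nat_ivl atMost_atLeast0)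
    qed
    then show ?thesis
      by (simp add: binomial_coeff_def sum_distrib_left power_add mult_ac)
  qed
  show ?A
    using shift[of "\<lambda>_. 1"] by (simp add: binomial_sum_minus_one)
  show ?B
    using shift[of "\<lambda>j. real j - 3"]
    by (simp add: binomial_first_moment_minus_one) (simp add: eval_nat_numeral)
qed


section \<open>The recurrence for \<Gamma> and the resulting polynomial identity\<close>

text \<open>Each defining relation is multiplied by \<open>n - 2 * j + 2\<close>, which is
  \<open>n\<close> for \<open>j = 1\<close> and \<open>n - 2\<close> for \<open>j = 2\<close>. At
  \<open>j = s + 3\<close> the term with \<open>G (Suc j)\<close> drops out, and outside the range
  both sides vanish.\<close>

lemma Gamma_recurrence:
  fixes n k s :: nat and \<Gamma> :: "nat \<Rightarrow> real"
  assumes "Gamma_relations n k s \<Gamma>" and "2 * s + 2 \<le> k" "k + 8 \<le> n"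
  defines "G \<equiv> \<lambda>j. if 1 \<le> j \<and> j \<le> s + 3 then \<Gamma> j else 0"
  shows "(real k - 2 * real s + real j - 2) * (real n - 2 * real j + 2) * G j =
    2 * real j * (real n - real j + 1) * G (Suc j) - binomial_coeff s j / 2"
proof -
  \<comment> \<open>The bound comes from 2j \<le> 2s + 6 \<le> k + 4 \<le> n - 4.\<close>
  have nz: "real n - 2 * real j + 2 > 0" if "j \<le> s + 3" for j
  proof -
    have "2 * j < n + 2" using that assms(2,3) by linarith
    then have "real (2 * j) < real (n + 2)" by (simp only: of_nat_less_iff)
    then show ?thesis by simp
  qed
  consider "j = 0" | "j = 1" | "j = 2" | "j \<in> {3..s + 2}" | "j = s + 3" | "j > s + 3"
    by fastforce
  then show ?thesis
  proof cases
    case 4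
    then have "(real k - 2 * real s + real j - 2) * \<Gamma> j =
          2 * real j * (real n - real j + 1) / (real n - 2 * real j + 2) * \<Gamma> (j + 1)
          - (-1) ^ (s + 3 - j) / (2 * (real n - 2 * real j + 2)) * real (s choose (j - 3))"
      using assms(1) unfolding Gamma_relations_def by blast
    moreover have "real n - 2 * real j + 2 \<noteq> 0" using nz[of j] 4 by simp
    moreover have "A * D * g = X * y - e * b / 2"
      if "A * g = X / D * y - e / (2 * D) * b" "D \<noteq> 0" for A D g X y e b :: real
      using that by (simp add: field_simps)
    ultimately show ?thesis
      using 4 by (simp add: G_def binomial_coeff_def)
  next
    case 1
    then show ?thesis by (simp add: G_def binomial_coeff_def)
  next
    case 2
    have \<Gamma>1: "(real k - 2 * real s - 1) * \<Gamma> 1 = 2 * \<Gamma> 2"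
      using assms(1) unfolding Gamma_relations_def by blast
    have "(real k - 2 * real s - 1) * real n * \<Gamma> 1 = real n * ((real k - 2 * real s - 1) * \<Gamma> 1)"
      by simp
    also have "\<dots> = 2 * real n * \<Gamma> 2"
      unfolding \<Gamma>1 by simp
    finally show ?thesis
      using 2 by (simp add: G_def binomial_coeff_def numeral_2_eq_2)
  next
    case 3
    then show ?thesis
      using assms(1) nz[of 2] unfolding Gamma_relations_def
      by (auto simp: G_def binomial_coeff_def numeral_3_eq_3 field_simps)
  next
    case 5
    then show ?thesis
      using assms(1) nz[of "s + 3"] unfolding Gamma_relations_def
      by (auto simp: G_def binomial_coeff_def field_simps)
  next
    case 6
    then show ?thesis by (simp add: G_def binomial_coeff_def binomial_eq_0)
  qed
qed

text \<open>\<open>R1\<close> and \<open>R2\<close> are the recurrence at \<open>j\<close> and \<open>j + 1\<close>; \<open>D\<close> is the corresponding relation between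
  consecutive coefficients of \<open>v\<^sup>3 (v - 1)\<^sup>s\<close>.\<close>

lemma three_term_collapse:
  fixes n d j k s :: real
  assumes R1: "(d + j - 2) * (n - 2 * j + 2) * G0 = 2 * j * (n - j + 1) * G1 - D0 / 2"
    and R2: "(d + j - 1) * (n - 2 * j) * G1 = 2 * (j + 1) * (n - j) * G2 - D1 / 2"
    and D: "(j - 2) * D1 = - (s - j + 3) * D0"
    and d: "d = k - 2 * s"
  shows "4 * (n - 2 * j) * (n - 2 * j + 2) * (d + j - 1) * (d + j - 2) * G0
    + 4 * (n - 2 * j - 2) * (n - 2 * j) * (n - 2 * j + 2) * (d + j - 1) * G1
    + ((n - 2 * j - 4) * (n - 2 * j - 2) * (n - 2 * j) * (n - 2 * j + 2)
        - (n - 2) * n * (n + 2) * (n + 4)) * G2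
    = - 2 * ((k + 2) * (n - 6) * D0 + (n\<^sup>2 - 4 * n + 8) * D1
        - (2 * k - 2 * s + n - 2) * ((j - 3) * D0))" (is "?L = ?R")
proof -
  \<comment> \<open>Once \<open>R1\<close> has replaced \<open>G0\<close>, the total coefficient of
    \<open>G1\<close> is \<open>4 * B\<close> times the left-hand coefficient of
    \<open>R2\<close>.\<close>
  define B where "B = 2 * j * (n - j + 1) + (n - 2 * j - 2) * (n - 2 * j + 2)"
  have "?L = 4 * (n - 2 * j) * (d + j - 1) * ((d + j - 2) * (n - 2 * j + 2) * G0)
    + 4 * (n - 2 * j - 2) * (n - 2 * j + 2) * ((d + j - 1) * (n - 2 * j) * G1)
    + ((n - 2 * j - 4) * (n - 2 * j - 2) * (n - 2 * j) * (n - 2 * j + 2)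
        - (n - 2) * n * (n + 2) * (n + 4)) * G2"
    by (simp add: algebra_simps)
  also have "\<dots> = 4 * B * ((d + j - 1) * (n - 2 * j) * G1) - 2 * (n - 2 * j) * (d + j - 1) * D0
    + ((n - 2 * j - 4) * (n - 2 * j - 2) * (n - 2 * j) * (n - 2 * j + 2)
        - (n - 2) * n * (n + 2) * (n + 4)) * G2"
    unfolding R1 B_def by (simp add: field_simps)
  \<comment> \<open>\<open>R2\<close> contributes \<open>8 * B * (j + 1) * (n - j) * G2\<close>,
    which cancels the given \<open>G2\<close> term exactly; this is where the constant
    (n-2)n(n+2)(n+4) enters.\<close>
  also have "\<dots> = - 2 * (n - 2 * j) * (d + j - 1) * D0 - 2 * B * D1"
    unfolding R2 B_def by (simp add: field_simps)
  \<comment> \<open>At \<open>j = 2\<close> the value of \<open>B\<close> is n^2 - 4n + 8, so the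
    difference has the factor \<open>j - 2\<close> and relation \<open>D\<close> applies to
    it.\<close>
  also have "\<dots> = - 2 * (n - 2 * j) * (d + j - 1) * D0 - 2 * (n\<^sup>2 - 4 * n + 8) * D1
      + (4 * n - 4 * j - 12) * ((j - 2) * D1)"
    unfolding B_def by (simp add: algebra_simps power2_eq_square)
  also have "\<dots> = ?R"
    unfolding D d by (simp add: algebra_simps power2_eq_square)
  finally show ?thesis .
qed

text \<open>Comparison of coefficients: v^(j+1) collects contributions of \<open>\<Gamma>\<close> at
  \<open>j\<close>, \<open>j + 1\<close> and \<open>j + 2\<close>, which
  \<open>three_term_collapse\<close> reduces to binomial coefficients. Their generating sums give
  the right-hand side.\<close>

lemma Gamma_sum_identity:
  fixes n k s :: nat and \<Gamma> :: "nat \<Rightarrow> real" and v :: real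
  assumes \<Gamma>: "Gamma_relations n k s \<Gamma>" "2 * s + 2 \<le> k" "k + 8 \<le> n"
    and d: "d = real k - 2 * real s"
  shows "(\<Sum>j = 1..s + 3. \<Gamma> j *
      (4 * (real n - 2 * j) * (real n - 2 * j + 2) * (d + j - 1) * (d + j - 2) * v ^ (j + 1)
       + 4 * (real n - 2 * j) * (real n - 2 * j + 2) * (real n - 2 * j + 4) * (d + j - 2) * v ^ j
       + ((real n - 2 * j) * (real n - 2 * j + 2) * (real n - 2 * j + 4) * (real n - 2 * j + 6)
          - (real n - 2) * n * (real n + 2) * (real n + 4)) * v ^ (j - 1)))
    = - 2 * ((real k + 2) * (real n - 6) * v ^ 4 * (v - 1) ^ s
       + ((real n)\<^sup>2 - 4 * n + 8) * v ^ 3 * (v - 1) ^ s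
       - real s * (2 * real k - 2 * real s + n - 2) * v ^ 5 * (v - 1) ^ (s - 1))"
proof -
  define G where "G j = (if 1 \<le> j \<and> j \<le> s + 3 then \<Gamma> j else 0)" for j
  define \<alpha> where "\<alpha> j = 4 * (real n - 2 * j) * (real n - 2 * j + 2) * (d + j - 1) * (d + j - 2)"
    for j :: nat
  define \<beta> where "\<beta> j = 4 * (real n - 2 * j) * (real n - 2 * j + 2) * (real n - 2 * j + 4) * (d + j - 2)"
    for j :: nat
  define \<gamma> where "\<gamma> j = (real n - 2 * j) * (real n - 2 * j + 2) * (real n - 2 * j + 4) * (real n - 2 * j + 6)
          - (real n - 2) * n * (real n + 2) * (real n + 4)" for j :: nat
  define \<delta> where "\<delta> = binomial_coeff s"
  let ?M = "s + 4"
  have G0: "G 0 = 0" "G ?M = 0" "G (Suc ?M) = 0"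
    by (simp_all add: G_def)
  \<comment> \<open>The subtracted constant is the value of the product at \<open>j = 1\<close>.
    Hence no v^0 term survives and the \<gamma> sum can be shifted twice.\<close>
  have \<gamma>1: "\<gamma> 1 = 0" by (simp add: \<gamma>_def algebra_simps)
  have \<delta>0: "\<delta> 0 = 0" "\<delta> ?M = 0"
    by (simp_all add: \<delta>_def binomial_coeff_def)
  have collapse: "\<alpha> j * G j + \<beta> (Suc j) * G (Suc j) + \<gamma> (Suc (Suc j)) * G (Suc (Suc j)) =
      - 2 * ((real k + 2) * (real n - 6) * \<delta> j + ((real n)\<^sup>2 - 4 * n + 8) * \<delta> (Suc j)
        - (2 * real k - 2 * real s + n - 2) * ((real j - 3) * \<delta> j))" for j
  proof -
    have R: "(d + real i - 2) * (real n - 2 * real i + 2) * G i =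
        2 * real i * (real n - real i + 1) * G (Suc i) - \<delta> i / 2" for i
      unfolding d G_def \<delta>_def by (rule Gamma_recurrence[OF \<Gamma>])
    have "(d + real j - 1) * (real n - 2 * real j) * G (Suc j) =
        2 * (real j + 1) * (real n - real j) * G (Suc (Suc j)) - \<delta> (Suc j) / 2"
      using R[of "Suc j"] by (simp add: algebra_simps)
    from three_term_collapse[OF R[of j] this binomial_coeff_step[of j s, folded \<delta>_def] d]
    show ?thesis
      by (simp add: \<alpha>_def \<beta>_def \<gamma>_def algebra_simps)
  qed
  have "(\<Sum>j = 1..s + 3. \<Gamma> j * (\<alpha> j * v ^ (j + 1) + \<beta> j * v ^ j + \<gamma> j * v ^ (j - 1))) =
      (\<Sum>j<?M. G j * (\<alpha> j * v ^ (j + 1) + \<beta> j * v ^ j + \<gamma> j * v ^ (j - 1)))"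
    by (intro sum.mono_neutral_cong_left) (auto simp: G_def)
  also have "\<dots> = (\<Sum>j<?M. \<alpha> j * G j * v ^ Suc j) + (\<Sum>j<?M. \<beta> j * G j * v ^ j)
      + (\<Sum>j<?M. \<gamma> j * G j * v ^ (j - 1))"
    by (simp add: sum.distrib[symmetric] algebra_simps)
  also have "(\<Sum>j<?M. \<beta> j * G j * v ^ j) = (\<Sum>j<?M. \<beta> (Suc j) * G (Suc j) * v ^ Suc j)"
    using G0 by (intro sum_lessThan_shift_zero[symmetric]) auto
  \<comment> \<open>The truncated exponent at \<open>j = 0\<close> is harmless because
    \<open>G 0 = 0\<close>.\<close>
  also have "(\<Sum>j<?M. \<gamma> j * G j * v ^ (j - 1)) = (\<Sum>j<?M. \<gamma> (Suc j) * G (Suc j) * v ^ j)"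
    using sum_lessThan_shift_zero[of "\<lambda>j. \<gamma> j * G j * v ^ (j - 1)" ?M] G0 by simp
  also have "\<dots> = (\<Sum>j<?M. \<gamma> (Suc (Suc j)) * G (Suc (Suc j)) * v ^ Suc j)"
    using G0 \<gamma>1 by (intro sum_lessThan_shift_zero[symmetric]) auto
  also have "(\<Sum>j<?M. \<alpha> j * G j * v ^ Suc j) + (\<Sum>j<?M. \<beta> (Suc j) * G (Suc j) * v ^ Suc j) + \<dots> =
      (\<Sum>j<?M. (\<alpha> j * G j + \<beta> (Suc j) * G (Suc j) + \<gamma> (Suc (Suc j)) * G (Suc (Suc j))) * v ^ Suc j)"
    by (simp only: sum.distrib[symmetric] distrib_right)
  also have "\<dots> = - 2 * ((real k + 2) * (real n - 6) * v * (\<Sum>j<?M. \<delta> j * v ^ j)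
       + ((real n)\<^sup>2 - 4 * n + 8) * (\<Sum>j<?M. \<delta> (Suc j) * v ^ Suc j)
       - (2 * real k - 2 * real s + n - 2) * v * (\<Sum>j<?M. (real j - 3) * \<delta> j * v ^ j))"
    unfolding collapse sum_distrib_left sum.distrib[symmetric] sum_subtractf[symmetric]
    by (intro sum.cong refl) (simp add: algebra_simps)
  also have "(\<Sum>j<?M. \<delta> (Suc j) * v ^ Suc j) = (\<Sum>j<?M. \<delta> j * v ^ j)"
    using \<delta>0 by (intro sum_lessThan_shift_zero) auto
  finally show ?thesis
    unfolding \<delta>_def binomial_coeff_sums \<alpha>_def \<beta>_def \<gamma>_def
    by (simp add: eval_nat_numeral mult_ac)
qed

section \<open>Existence of the coefficients and verification of the equation\<close>

text \<open>The relations are triangular: the last one fixes \<open>\<Gamma> (s + 3)\<close>, and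
  each other gives \<open>\<Gamma> j\<close> from \<open>\<Gamma> (j + 1)\<close>. The left-hand
  coefficients are positive because \<open>k \<ge> 2 * s + 2\<close>.\<close>

lemma Gamma_relations_exist:
  fixes n k s :: nat
  assumes "2 * s + 2 \<le> k"
  shows "\<exists>\<Gamma>. Gamma_relations n k s \<Gamma>"
proof -
  (* Downward recursion: H m is the value of \<Gamma> at s + 3 - m. *)
  define F where "F j y = (if j = 1 then 2 * y / (real k - 2 * real s - 1)
     else if j = 2 then 4 * (real n - 1) / (real n - 2) * y / (real k - 2 * real s)
     else (2 * real j * (real n - real j + 1) / (real n - 2 * real j + 2) * y
          - (-1) ^ (s + 3 - j) / (2 * (real n - 2 * real j + 2)) * real (s choose (j - 3)))
        / (real k - 2 * real s + real j - 2))" for j :: nat and y :: real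
  define H where "H = rec_nat (- 1 / (2 * (real n - 2 * real s - 4)) / (real k - real s + 1))
      (\<lambda>m y. F (s + 2 - m) y)"
  define \<Gamma> where "\<Gamma> j = H (s + 3 - j)" for j
  have step: "\<Gamma> j = F j (\<Gamma> (j + 1))" if "j \<le> s + 2" for j
  proof -
    have "s + 3 - j = Suc (s + 2 - j)" "s + 2 - (s + 2 - j) = j" "s + 3 - (j + 1) = s + 2 - j"
      using that by auto
    then show ?thesis by (simp add: \<Gamma>_def H_def)
  qed
  have ks: "real k \<ge> 2 * real s + 2"
    using assms by linarith
  have "Gamma_relations n k s \<Gamma>"
    unfolding Gamma_relations_def
  proof (intro conjI ballI)
    show "(real k - 2 * real s - 1) * \<Gamma> 1 = 2 * \<Gamma> 2"
      using step[of 1] ks by (simp add: F_def numeral_2_eq_2)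
    show "(real k - 2 * real s) * \<Gamma> 2 = 4 * (real n - 1) / (real n - 2) * \<Gamma> 3"
      using step[of 2] ks by (simp add: F_def)
    show "(real k - 2 * real s + real j - 2) * \<Gamma> j =
          2 * real j * (real n - real j + 1) / (real n - 2 * real j + 2) * \<Gamma> (j + 1)
          - (-1) ^ (s + 3 - j) / (2 * (real n - 2 * real j + 2)) * real (s choose (j - 3))"
      if "j \<in> {3..s + 2}" for j
      using step[of j] ks that by (simp add: F_def)
    show "(real k - real s + 1) * \<Gamma> (s + 3) = - 1 / (2 * (real n - 2 * real s - 4))"
      using ks by (simp add: \<Gamma>_def H_def)
  qed
  then show ?thesis
    by blast
qed

text \<open>Apply the bi-Laplacian formula to each summand and factor out a common power of 1 +
  |x|^2 together with \<open>p x\<close>; what remains is \<open>Gamma_sum_identity\<close>.\<close>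

lemma Psi_is_solution:
  fixes n k s :: nat and p :: "real ^ 'n \<Rightarrow> real"
  assumes n: "CARD('n) = n" and ks: "2 * s + 2 \<le> k" "k + 8 \<le> n"
    and hom: "homogeneous_polynomial (k - 2 * s) p" and harm: "\<And>x. laplacian p x = 0"
    and \<Gamma>: "Gamma_relations n k s \<Gamma>"
  shows "is_solution n k s p (Psi n s \<Gamma> p)"
proof -
  define c where "c = (real n - 4) / (4 * (real n - 1))"
  define a where "a j = - (real n - 2 * real j) / 2" for j :: nat
  define h where "h j x = (1 + (norm x)\<^sup>2) powr a j * p x" for j and x :: "real ^ 'n"
  define d where "d = real k - 2 * real s"
  have d: "real (k - 2 * s) = d"
    using ks by (simp add: d_def of_nat_diff)
  have Psi: "Psi n s \<Gamma> p = (\<lambda>x. \<Sum>j = 1..s + 3. (c * \<Gamma> j) * h j x)"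
    unfolding Psi_def h_def c_def a_def by (simp add: sum_distrib_left mult_ac fun_eq_iff)
  have Ch: "C_k m (\<lambda>x. (1 + (norm x)\<^sup>2) powr b * p x)" for m b
    by (intro C_k_mult C_k_one_plus_norm_sq_powr homogeneous_polynomial_C_k[OF hom])
  have C2h: "C_k 2 (h j)" for j
    unfolding h_def by (rule Ch)
  \<comment> \<open>Needed to use linearity of the outer Laplacian as well.\<close>
  have C2Lh: "C_k 2 (laplacian (h j))" for j
    unfolding h_def laplacian_powr_mult_harmonic[OF hom harm]
    by (intro C_k_add C_k_mult[OF C_k_const] Ch)
  have "C_k 4 (Psi n s \<Gamma> p)"
    unfolding Psi h_def by (intro C_k_sum C_k_mult[OF C_k_const] Ch)
  moreover have "laplacian (laplacian (Psi n s \<Gamma> p)) x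
      - (real n - 2) * real n * (real n + 2) * (real n + 4) * (1 + (norm x)\<^sup>2) powr (-4) * Psi n s \<Gamma> p x
    = - L1_w n k s p x" for x
  proof -
    define v where "v = 1 + (norm x)\<^sup>2"
    \<comment> \<open>The lowest exponent that occurs, \<open>a 1 - 4\<close>; all other powers are
      \<open>W\<close> times a natural power of \<open>v\<close>.\<close>
    define W where "W = v powr (- real n / 2 - 3)"
    define K where "K = (real n - 2) * real n * (real n + 2) * (real n + 4)"
    define E where "E = (real k + 2) * (real n - 6) * v ^ 4 * (v - 1) ^ s
       + ((real n)\<^sup>2 - 4 * n + 8) * v ^ 3 * (v - 1) ^ s
       - real s * (2 * real k - 2 * real s + n - 2) * v ^ 5 * (v - 1) ^ (s - 1)"
    have v: "v > 0"
      unfolding v_def by (rule one_plus_norm_sq_pos)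
    have powr: "v powr b = W * v ^ m" if "b = - real n / 2 - 3 + real m" for b m
      unfolding that W_def using v by (simp add: powr_add powr_realpow)
    have LLh: "laplacian (laplacian (h j)) x - K * v powr (-4) * h j x = W * p x *
      (4 * (real n - 2 * j) * (real n - 2 * j + 2) * (d + j - 1) * (d + j - 2) * v ^ (j + 1)
       + 4 * (real n - 2 * j) * (real n - 2 * j + 2) * (real n - 2 * j + 4) * (d + j - 2) * v ^ j
       + ((real n - 2 * j) * (real n - 2 * j + 2) * (real n - 2 * j + 4) * (real n - 2 * j + 6)
          - K) * v ^ (j - 1))" if "1 \<le> j" for j :: nat
    proof -
      have p2: "v powr (a j - 2) = W * v ^ (j + 1)" and p3: "v powr (a j - 3) = W * v ^ j"
        and p4: "v powr (a j - 4) = W * v ^ (j - 1)"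
        by (intro powr; use that in \<open>simp add: a_def field_simps of_nat_diff\<close>)+
      \<comment> \<open>The potential term has the same exponent as the lowest term of the
        bi-Laplacian, so the two merge into one coefficient.\<close>
      have "v powr (-4) * v powr a j = W * v ^ (j - 1)"
        using p4 by (simp add: powr_add[symmetric])
      then have Kh: "K * v powr (-4) * h j x = W * p x * K * v ^ (j - 1)"
        by (simp add: h_def v_def)
      \<comment> \<open>The dimension cancels against the \<open>- n / 2\<close> in
        \<open>a j\<close>.\<close>
      have b: "d + j - 1 = a j - 1 + real CARD('n) / 2 + real (k - 2 * s)"
        unfolding n d a_def by (simp add: field_simps)
      have "laplacian (laplacian (h j)) x =
        (16 * a j * (a j - 1) * (d + j - 1) * (d + j - 1 - 1) * (W * v ^ (j + 1))
          - 32 * a j * (a j - 1) * (a j - 2) * (d + j - 1 - 1) * (W * v ^ j)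
          + 16 * a j * (a j - 1) * (a j - 2) * (a j - 3) * (W * v ^ (j - 1))) * p x"
        unfolding h_def p2[symmetric] p3[symmetric] p4[symmetric]
        unfolding v_def by (rule bilaplacian_powr_mult_harmonic[OF hom harm b])
      then show ?thesis
        unfolding Kh a_def by (simp add: field_simps)
    qed
    have "laplacian (laplacian (Psi n s \<Gamma> p)) x - K * v powr (-4) * Psi n s \<Gamma> p x =
        (\<Sum>j = 1..s + 3. (c * \<Gamma> j) * (laplacian (laplacian (h j)) x - K * v powr (-4) * h j x))"
      unfolding Psi laplacian_lincomb[OF C2h] laplacian_lincomb[OF C2Lh]
      by (simp add: right_diff_distrib sum_subtractf sum_distrib_left mult_ac)
    also have "\<dots> = c * W * p x * (\<Sum>j = 1..s + 3. \<Gamma> j *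
      (4 * (real n - 2 * j) * (real n - 2 * j + 2) * (d + j - 1) * (d + j - 2) * v ^ (j + 1)
       + 4 * (real n - 2 * j) * (real n - 2 * j + 2) * (real n - 2 * j + 4) * (d + j - 2) * v ^ j
       + ((real n - 2 * j) * (real n - 2 * j + 2) * (real n - 2 * j + 4) * (real n - 2 * j + 6)
          - K) * v ^ (j - 1)))"
      unfolding sum_distrib_left by (intro sum.cong refl, subst LLh) (simp_all only: mult_ac atLeastAtMost_iff)
    also have "\<dots> = - (2 * c * (W * p x * E))"
      unfolding K_def Gamma_sum_identity[OF \<Gamma> ks d_def] E_def[symmetric] by simp
    also have "\<dots> = - L1_w n k s p x"
    proof -
      have q4: "inverse (v powr ((real n - 2) / 2)) = W * v ^ 4"
        and q3: "inverse (v powr (real n / 2)) = W * v ^ 3"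
        and q5: "inverse (v powr ((real n - 4) / 2)) = W * v ^ 5"
        unfolding powr_minus[symmetric] by (intro powr; simp add: field_simps)+
      \<comment> \<open>For \<open>s = 0\<close> both truncated exponents in the second equation are
        0.\<close>
      have norm: "norm x ^ (2 * s) = (v - 1) ^ s" "norm x ^ (2 * s - 2) = (v - 1) ^ (s - 1)"
        by (simp_all add: v_def power_mult[symmetric] right_diff_distrib')
      \<comment> \<open>This accounts for the factor -2 in
        \<open>Gamma_sum_identity\<close>.\<close>
      have c2: "(real n - 4) / (2 * (real n - 1)) = 2 * c"
        unfolding c_def using times_divide_times_eq[of 2 2 "real n - 4" "2 * (real n - 1)"] by simp
      show ?thesis
        unfolding L1_w_def v_def[symmetric] divide_inverse[of _ "_ powr _"] q3 q4 q5 norm c2 E_def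
        by (simp add: algebra_simps)
    qed
    finally show ?thesis unfolding K_def v_def .
  qed
  ultimately show ?thesis
    unfolding is_solution_def by blast
qed

text \<open>The first conjunct ensures that the second is not vacuous.\<close>

theorem proposition4p4:
  fixes n k s :: nat and p :: "real ^ 'n \<Rightarrow> real"
  assumes "CARD('n) = n" and "n \<ge> 10"
    and "k \<in> {2..n - 8}"
    and "s \<in> {0..(k - 2) div 2}"
    and "homogeneous_polynomial (k - 2 * s) p"
    and "\<forall>x. laplacian p x = 0"
  shows "(\<exists>\<Gamma>. Gamma_relations n k s \<Gamma>) \<and>
         (\<forall>\<Gamma>. Gamma_relations n k s \<Gamma> \<longrightarrow> is_solution n k s p (Psi n s \<Gamma> p))"
proof -
  \<comment> \<open>Since \<open>k\<close> is at least 2, neither \<open>k - 2\<close> nor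
    \<open>n - 8\<close> is truncated.\<close>
  have ks: "2 * s + 2 \<le> k" "k + 8 \<le> n"
    using assms(2-4) by auto
  show ?thesis
    using Gamma_relations_exist[OF ks(1)] Psi_is_solution[OF assms(1) ks assms(5)] assms(6) by blast
qed

end
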